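(* Let $G=(V,E)$ be a finite simple directed graph with $n$ nodes, and let $V_\ell\subseteq V$ be a nonempty set of $m$ nodes (the leaders). Suppose that every leader has at least two followers (nodes of $V\setminus V_\ell$) among its in-neighbors. Then $$\delta(G,V_\ell) > \zeta(G,V_\ell).$$
   Context: Graphs. $G=(V,E)$ is a finite simple directed graph (no self-loops, no multiple edges); $e_{ij}$ denotes an edge from $v_i$ to $v_j$. A node $v_j$ is an in-neighbor of $v_i$ if there is an edge from $v_j$ to $v_i$. The distance $d(u,v)\in\{0,1,2,\dots\}\cup\{\infty\}$ is the number of edges on a shortest directed path from $u$ to $v$, with $d(v,v)=0$ and $d(u,v)=\infty$ if there is no path from $u$ to $v$. Given a leader set $V_\ell=\{\ell_1,\dots,\ell_m\}\subseteq V$, the nodes in $V\setminus V_\ell$ are called followers. Distance-based quantity $\delta(G,V_\ell)$. The distance-to-leaders (DL) vector of a node $v\in V$ is $(d(v,\ell_1),\dots,d(v,\ell_m))$. A finite sequence $(\mathcal D_1,\dots,\mathcal D_k)$ of DL vectors of nodes of $G$ is pseudo-monotonically increasing (PMI) if for every $i$ there exists $\pi(i)\in\{1,\dots,m\}$ such that $[\mathcal D_i]_{\pi(i)}<[\mathcal D_j]_{\pi(i)}$ for all $j>i$ (here every finite number is $<\infty$, and $\infty<\infty$ is false; for the last vector the condition is vacuous). $\delta(G,V_\ell)$ is the length of a longest PMI sequence all of whose members are DL vectors of nodes of $G$ having at least one finite entry. Zero-forcing quantity $\zeta(G,V_\ell)$. Color the nodes of $V_\ell$ black and all other nodes white. Zero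 forcing rule: if a black node $v$ has exactly one white in-neighbor $u$, then $u$ is recolored black. The rule is applied repeatedly until no further color change is possible; the resulting set of black nodes is uniquely determined and is called the derived set $\mathrm{dset}(G,V_\ell)$. Define $\zeta(G,V_\ell)=|\mathrm{dset}(G,V_\ell)|$. *)

theory Defs
  imports "Graph_Theory.Graph_Theory" "HOL-Library.Extended_Nat"
begin

definition in_neighbors :: "('a, 'b) pre_digraph \<Rightarrow> 'a \<Rightarrow> 'a set" where
  "in_neighbors G v = {u. u \<rightarrow>\<^bsub>G\<^esub> v}"

section \<open>Distances and pseudo-monotonically increasing sequences\<close>

text \<open>The infimum over the empty set is \<open>\<infinity>\<close>, the value required if there is no path.\<close>

definition distance :: "('a, 'b) pre_digraph \<Rightarrow> 'a \<Rightarrow> 'a \<Rightarrow> enat" where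
  "distance G u v = (INF p \<in> {p. pre_digraph.apath G u p v}. enat (length p))"

text \<open>
  A vector with one entry per leader is a function on the leader set \<open>L\<close>, so that the leaders
  themselves serve as indices and no enumeration of \<open>L\<close> has to be chosen. Restricting to \<open>L\<close>
  makes two vectors equal iff they agree in all entries.
\<close>

definition DL_vector :: "('a, 'b) pre_digraph \<Rightarrow> 'a set \<Rightarrow> 'a \<Rightarrow> 'a \<Rightarrow> enat" where
  "DL_vector G L v = restrict (\<lambda>l. distance G v l) L"

definition PMI :: "('a, 'b) pre_digraph \<Rightarrow> 'a set \<Rightarrow> ('a \<Rightarrow> enat) list \<Rightarrow> bool" where
  "PMI G L Ds \<longleftrightarrow> set Ds \<subseteq> DL_vector G L ` verts G \<and>
     (\<forall>i < length Ds. \<exists>l \<in> L. \<forall>j. i < j \<and> j < length Ds \<longrightarrow> (Ds ! i) l < (Ds ! j) l)"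

definition delta :: "('a, 'b) pre_digraph \<Rightarrow> 'a set \<Rightarrow> nat" where
  "delta G L = Max {length Ds | Ds. PMI G L Ds \<and> (\<forall>D \<in> set Ds. \<exists>l \<in> L. D l \<noteq> \<infinity>)}"

section \<open>Zero forcing\<close>

text \<open>A colouring is given by its set of black nodes; one step recolours a single node.\<close>

definition force_step :: "('a, 'b) pre_digraph \<Rightarrow> 'a set \<Rightarrow> 'a set \<Rightarrow> bool" where
  "force_step G B B' \<longleftrightarrow> (\<exists>v \<in> B. \<exists>u. in_neighbors G v - B = {u} \<and> B' = insert u B)"

text \<open>Existence and uniqueness of the derived set are shown below.\<close>

definition dset :: "('a, 'b) pre_digraph \<Rightarrow> 'a set \<Rightarrow> 'a set" where
  "dset G L = (THE D. (force_step G)\<^sup>*\<^sup>* L D \<and> (\<nexists>D'. force_step G D D'))"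

definition zeta :: "('a, 'b) pre_digraph \<Rightarrow> 'a set \<Rightarrow> nat" where
  "zeta G L = card (dset G L)"

section \<open>The definitions are meaningful\<close>

lemma (in wf_digraph) distance_eq_mu:
  "ereal_of_enat (distance G u v) = \<mu> (\<lambda>_. 1) u v"
proof -
  have cost: "awalk_cost (\<lambda>_. 1) p = real (length p)" for p :: "'b list"
    by (induct p) auto
  have shorten: "\<exists>q. apath u q v \<and> length q \<le> length p" if "awalk u p v" for p
  proof -
    have "apath u (awalk_to_apath p) v" using that by (rule apath_awalk_to_apath)
    moreover have "length (awalk_to_apath p) \<le> length p"
      using awalk_to_path_no_neg_cyc_cost[OF that, of "\<lambda>_. 1"] by (auto simp: cost)
    ultimately show ?thesis by blast
  qed
  show ?thesis
  proof (cases "\<exists>p. awalk u p v")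
    case False
    then have "{p. awalk u p v} = {}" "{p. apath u p v} = {}" by (auto simp: apath_def)
    then show ?thesis by (simp add: distance_def \<mu>_def top_enat_def top_ereal_def)
  next
    case True
    then have ne: "{p. apath u p v} \<noteq> {}" using shorten by blast
    have "(INF p \<in> {p. apath u p v}. enat (length p)) \<in> (\<lambda>p. enat (length p)) ` {p. apath u p v}"
      using ne by (metis (no_types, lifting) Inf_enat_def LeastI_ex empty_is_image ex_in_conv)
    then obtain p where p: "apath u p v" "distance G u v = enat (length p)"
      by (auto simp: distance_def)
    have min: "length p \<le> length q" if "apath u q v" for q
    proof -
      have "distance G u v \<le> enat (length q)"
        unfolding distance_def using that by (auto intro: INF_lower)
      then show ?thesis by (simp add: p)
    qed
    have "\<mu> (\<lambda>_. 1) u v = ereal (real (length p))"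
      unfolding \<mu>_def cost
    proof (rule antisym)
      show "(INF q \<in> {q. awalk u q v}. ereal (real (length q))) \<le> ereal (real (length p))"
        using p by (auto intro!: INF_lower simp: apath_def)
      show "ereal (real (length p)) \<le> (INF q \<in> {q. awalk u q v}. ereal (real (length q)))"
        using shorten min by (force intro!: INF_greatest intro: order_trans)
    qed
    then show ?thesis by (simp add: p)
  qed
qed

lemma PMI_distinct:
  assumes "PMI G L Ds"
  shows "distinct Ds"
  unfolding distinct_conv_nth
proof (intro allI impI)
  have *: "Ds ! i \<noteq> Ds ! j" if "i < j" "j < length Ds" for i j
  proof -
    have "i < length Ds" using that by simp
    then obtain l where "\<forall>j. i < j \<and> j < length Ds \<longrightarrow> (Ds ! i) l < (Ds ! j) l"
      using assms unfolding PMI_def by blast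
    then have "(Ds ! i) l < (Ds ! j) l" using that by blast
    then show ?thesis by auto
  qed
  fix i j assume "i < length Ds" "j < length Ds" "i \<noteq> j"
  then show "Ds ! i \<noteq> Ds ! j" using *[of i j] *[of j i] by (metis linorder_neqE_nat)
qed

lemma (in fin_digraph) finite_PMI_lengths:
  "finite {length Ds | Ds. PMI G L Ds \<and> (\<forall>D \<in> set Ds. \<exists>l \<in> L. D l \<noteq> \<infinity>)}"
proof -
  have "length Ds \<le> card (verts G)" if "PMI G L Ds" for Ds
  proof -
    have "length Ds = card (set Ds)" using PMI_distinct[OF that] by (simp add: distinct_card)
    also have "\<dots> \<le> card (DL_vector G L ` verts G)"
      using that by (intro card_mono) (auto simp: PMI_def)
    also have "\<dots> \<le> card (verts G)" by (simp add: card_image_le)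
    finally show ?thesis .
  qed
  then show ?thesis by (intro finite_subset[OF _ finite_atMost[of "card (verts G)"]]) auto
qed

lemma PMI_Nil: "PMI G L []"
  by (simp add: PMI_def)

lemma (in fin_digraph) ex1_dset:
  assumes "L \<subseteq> verts G"
  shows "\<exists>!D. (force_step G)\<^sup>*\<^sup>* L D \<and> (\<nexists>D'. force_step G D D')"
proof (rule ex_ex1I)
  show "\<exists>D. (force_step G)\<^sup>*\<^sup>* L D \<and> (\<nexists>D'. force_step G D D')"
    using assms
  proof (induction "card (verts G - L)" arbitrary: L rule: less_induct)
    case less
    show ?case
    proof (cases "\<exists>B. force_step G L B")
      case True
      then obtain u v where u: "in_neighbors G v - L = {u}" "force_step G L (insert u L)"
        unfolding force_step_def by blast
      have "u \<in> verts G" "u \<notin> L" using u(1) adj_in_verts by (auto simp: in_neighbors_def)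
      then have "card (verts G - insert u L) < card (verts G - L)"
        by (intro psubset_card_mono) auto
      with less \<open>u \<in> verts G\<close> u(2) show ?thesis
        by (meson converse_rtranclp_into_rtranclp insert_subset)
    qed blast
  qed
next
  have mono: "B \<subseteq> F" if "(force_step G)\<^sup>*\<^sup>* L B" "L \<subseteq> F" "\<nexists>D'. force_step G F D'" for B F
    using that(1)
  proof (induction rule: rtranclp_induct)
    case base
    show ?case by fact
  next
    case (step B B')
    then obtain u v where v: "v \<in> B" "in_neighbors G v - B = {u}" "B' = insert u B"
      unfolding force_step_def by blast
    have "u \<in> F"
    proof (rule ccontr)
      assume "u \<notin> F"
      then have "in_neighbors G v - F = {u}" using v(2) step.IH by blast
      then show False using that(3) v(1) step.IH unfolding force_step_def by blast
    qed
    then show ?case using v(3) step.IH by blast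
  qed
  have incr: "L \<subseteq> B" if "(force_step G)\<^sup>*\<^sup>* L B" for B
    using that by (induction rule: rtranclp_induct) (auto simp: force_step_def)
  fix D E
  assume "(force_step G)\<^sup>*\<^sup>* L D \<and> (\<nexists>D'. force_step G D D')"
    and "(force_step G)\<^sup>*\<^sup>* L E \<and> (\<nexists>D'. force_step G E D')"
  then show "D = E" using mono incr by (metis subset_antisym)
qed

end

theory Submission
  imports Defs
begin

text \<open>
  A leader with two white in-neighbors cannot force, so the derived set is just the leader set and
  \<open>\<zeta> = m\<close>. On the other hand, a leader is the only node at distance \<open>0\<close> from itself, so listing the
  leaders in any order is PMI, and one follower adjacent to a leader can still be appended.
\<close>

context wf_digraph
begin

lemma distance_self:
  assumes "v \<in> verts G"
  shows "distance G v v = 0"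
proof -
  have "distance G v v \<le> enat (length [])"
    unfolding distance_def by (rule INF_lower2[of "[]"]) (use assms in \<open>simp_all add: apath_Nil_iff\<close>)
  then show ?thesis by (simp flip: zero_enat_def)
qed

lemma distance_pos:
  assumes "u \<noteq> v"
  shows "0 < distance G u v"
proof -
  have "1 \<le> distance G u v"
    unfolding distance_def
  \<comment> \<open>The bound holds even if no path exists, where the infimum is
    \<open>\<infinity>\<close>; otherwise only the empty path has length 0, and it cannot join
    distinct nodes.\<close>
  proof (rule INF_greatest)
    fix p assume "p \<in> {p. apath u p v}"
    then have "p \<noteq> []" using assms by (auto simp: apath_Nil_iff)
    then show "1 \<le> enat (length p)" by (cases p) (simp_all add: one_enat_def)
  qed
  then show ?thesis by (simp add: zero_less_iff_neq_zero) auto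
qed

text \<open>The arc itself is an \<open>apath\<close> only if \<open>u\<close> and \<open>v\<close>
  differ; extracting a path from reachability covers loops as well.\<close>

lemma distance_adj_finite:
  assumes "u \<rightarrow>\<^bsub>G\<^esub> v"
  shows "distance G u v \<noteq> \<infinity>"
proof -
  have "u \<rightarrow>\<^sup>*\<^bsub>G\<^esub> v" using assms by (rule reachable_adjI)
  then obtain p where "apath u p v" by (auto simp: reachable_apath)
  then have "distance G u v \<le> enat (length p)"
    unfolding distance_def by (auto intro: INF_lower)
  then show ?thesis by (cases "distance G u v") simp_all
qed

end

lemma (in fin_digraph) delta_ge_length:
  assumes "PMI G L Ds" and "\<forall>D \<in> set Ds. \<exists>l \<in> L. D l \<noteq> \<infinity>"
  shows "length Ds \<le> delta G L"
  unfolding delta_def by (rule Max_ge[OF finite_PMI_lengths]) (use assms in blast)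

lemma (in fin_digraph) card_less_delta:
  assumes L: "L \<subseteq> verts G" and u: "u \<notin> L" "u \<rightarrow>\<^bsub>G\<^esub> l" and l: "l \<in> L"
  shows "card L < delta G L"
proof -
  have "finite L" using L by (rule finite_subset) simp
  then obtain xs where xs: "set xs = L" "distinct xs" using finite_distinct_list by blast
  have len: "length xs = card L" using distinct_card[OF xs(2)] xs(1) by simp
  \<comment> \<open>The follower goes last, where its vector need not lie below any other.\<close>
  define ys where "ys = xs @ [u]"
  define Ds where "Ds = map (DL_vector G L) ys"
  have ys: "distinct ys" "set ys = insert u L" using xs u(1) by (auto simp: ys_def)
  have uv: "u \<in> verts G" using u(2) by (rule adj_in_verts)
  have "\<exists>k \<in> L. \<forall>j. i < j \<and> j < length Ds \<longrightarrow> (Ds ! i) k < (Ds ! j) k" if i: "i < length Ds" for i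
  proof (cases "i < length xs")
    case True
    then have k: "ys ! i \<in> L" using xs by (auto simp: ys_def nth_append)
    show ?thesis
    proof (intro bexI[OF _ k] allI impI)
      fix j assume j: "i < j \<and> j < length Ds"
      \<comment> \<open>Distinctness of \<open>ys\<close> treats later leaders and the final
        \<open>u\<close> alike.\<close>
      then have "ys ! j \<noteq> ys ! i" using ys(1) i by (auto simp: Ds_def nth_eq_iff_index_eq)
      then have "distance G (ys ! i) (ys ! i) < distance G (ys ! j) (ys ! i)"
        using k L distance_self[of "ys ! i"] distance_pos[of "ys ! j" "ys ! i"] by auto
      then show "(Ds ! i) (ys ! i) < (Ds ! j) (ys ! i)"
        using i j k by (simp add: Ds_def DL_vector_def)
    qed
  next
    \<comment> \<open>Here \<open>i\<close> is the last position, so the condition is vacuous and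
      any leader serves as index.\<close>
    case False
    then have "\<not> (i < j \<and> j < length Ds)" for j by (auto simp: Ds_def ys_def)
    then show ?thesis using l by blast
  qed
  moreover have "set Ds \<subseteq> DL_vector G L ` verts G" using ys L uv by (auto simp: Ds_def)
  ultimately have "PMI G L Ds" by (auto simp: PMI_def)
  \<comment> \<open>The finite entry is at \<open>l\<close> for \<open>u\<close>, and at the leader
    itself, with value 0, for a leader.\<close>
  moreover have "\<forall>D \<in> set Ds. \<exists>k \<in> L. D k \<noteq> \<infinity>"
  proof
    fix D assume "D \<in> set Ds"
    then obtain v where v: "D = DL_vector G L v" "v \<in> insert u L" using ys by (auto simp: Ds_def)
    show "\<exists>k \<in> L. D k \<noteq> \<infinity>"
    proof (cases "v = u")
      case True
      then have "D l \<noteq> \<infinity>" using v l distance_adj_finite[OF u(2)] by (simp add: DL_vector_def)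
      then show ?thesis using l by blast
    next
      case False
      then have "v \<in> L" using v by simp
      then have "D v = 0" using v L distance_self[of v] by (auto simp: DL_vector_def)
      then show ?thesis using \<open>v \<in> L\<close> by (intro bexI[of _ v]) simp_all
    qed
  qed
  ultimately have "length Ds \<le> delta G L" by (rule delta_ge_length)
  then show ?thesis using len by (simp add: Ds_def ys_def)
qed

text \<open>Any nontrivial run of the forcing rule would have to begin with a step from
  \<open>L\<close>, so the only run is the empty one.\<close>

lemma dset_eq_self:
  assumes "\<nexists>B. force_step G L B"
  shows "dset G L = L"
  unfolding dset_def
proof (rule the_equality)
  show "(force_step G)\<^sup>*\<^sup>* L L \<and> (\<nexists>B. force_step G L B)" using assms by simp
next
  fix D assume "(force_step G)\<^sup>*\<^sup>* L D \<and> (\<nexists>D'. force_step G D D')"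
  then have "(force_step G)\<^sup>*\<^sup>* L D" by (rule conjunct1)
  then show "D = L"
  proof (cases rule: converse_rtranclpE)
    case (step B)
    then show ?thesis using assms by blast
  qed simp
qed

theorem theorem3p1:
  fixes G :: "('a, 'b) pre_digraph" and L :: "'a set"
  assumes "digraph G"
    and "L \<subseteq> verts G"
    and "L \<noteq> {}"
    and "\<forall>l \<in> L. card (in_neighbors G l \<inter> (verts G - L)) \<ge> 2"
  shows "delta G L > zeta G L"
proof -
  interpret digraph G by fact
  \<comment> \<open>This turns the hypothesis on followers into one on the set of white
    in-neighbors, which \<open>force_step\<close> requires to be a singleton.\<close>
  have followers: "in_neighbors G l \<inter> (verts G - L) = in_neighbors G l - L" for l
    using adj_in_verts by (auto simp: in_neighbors_def)
  have "\<nexists>B. force_step G L B"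
    using assms(4) by (auto simp: force_step_def followers)
  then have "zeta G L = card L" by (simp add: zeta_def dset_eq_self)
  obtain l where l: "l \<in> L" using assms(3) by blast
  then have "2 \<le> card (in_neighbors G l - L)" using assms(4) by (simp add: followers)
  then have "in_neighbors G l - L \<noteq> {}" by force
  then obtain u where "u \<notin> L" "u \<rightarrow>\<^bsub>G\<^esub> l" by (auto simp: in_neighbors_def)
  with \<open>zeta G L = card L\<close> show ?thesis using card_less_delta[OF assms(2)] l by simp
qed

end
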